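(* Let $\Theta\subseteq\mathbb{R}$ be the parameter space, let $\theta_0\in\Theta$, and let $\Theta_0=\{\theta_0\}$, $\Theta_{-1}=\{\theta\in\Theta:\theta<\theta_0\}$ and $\Theta_{1}=\{\theta\in\Theta:\theta>\theta_0\}$. Let $\varphi$ be a decision function of the data $x$ that takes values in $\{-1,0,1\}$, such that we accept $\Theta_i$ if $\varphi(x)=i$. Let $0<\alpha<1$. Under an absolutely continuous prior for $\theta$ (with proper, absolutely continuous posterior) and the loss function \[ L_{(1)}(\theta,\varphi) = \begin{cases} 0, & \text{if } \theta\in\Theta_i\text{ and }\varphi=i, \quad i\in \{-1,0,1\}, \\ \alpha/2, & \text{if } \theta\notin\Theta_0 \text{ and }\varphi=0,\\ 1, & \text{if } \theta\in\Theta_{i}\cup\Theta_0 \text{ and }\varphi=-i,\quad i\in\{-1,1\},\end{cases} \] the Bayes test is to reject $\Theta_0$ if $\theta_0$ is not contained in the central $1-\alpha$ credible interval $(q_{\alpha/2}(\theta|x),\,q_{1-\alpha/2}(\theta|x))$.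
   Context: The parameter $\theta$ is real-valued, with parameter space $\Theta\subseteq\mathbb{R}$; $\mathrm{P}(\cdot|x)$ denotes posterior probability given the data $x$. For $0<\beta<1$, $q_\beta(\theta|x)$ denotes the posterior quantile function of $\theta$, i.e. $\mathrm{P}(\theta<q_\beta(\theta|x)\,|\,x)=\beta$ (take the smallest such value if there are several). The interval $(q_{\alpha/2}(\theta|x),q_{1-\alpha/2}(\theta|x))$ is called the central $1-\alpha$ credible interval (or set). Rejecting $\Theta_0$ means $\varphi(x)\neq 0$, i.e. $\varphi(x)\in\{-1,1\}$; accepting $\Theta_0$ means $\varphi(x)=0$. A Bayes test (Bayes decision rule) is a decision function which, for each $x$, chooses a decision minimizing the posterior expected loss $\mathrm{E}(L_{(1)}(\theta,\varphi)|x)$; if several decisions attain the minimum, any of them may be chosen. Saying that the Bayes test is to reject $\Theta_0$ if a condition holds means that the test which rejects $\Theta_0$ when the condition holds, and accepts it otherwise, is a Bayes test (upon rejection, the decision in $\{-1,1\}$ being the one with smaller posterior expected loss). *)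

theory Defs
  imports "HOL-Probability.Probability"
begin

text \<open>
  The parameter space \<open>\<Theta>\<close> is an arbitrary (not necessarily Borel) set of reals. Priors and posteriors
  are measures on the trace \<open>\<sigma>\<close>-algebra \<open>restrict_space borel \<Theta>\<close>; absolute continuity refers to the
  induced measure on the real line. The prior may be improper; \<open>\<sigma>\<close>-finiteness ensures that it has a
  finite-valued Lebesgue density.
\<close>

definition abs_continuous_dist :: "real measure \<Rightarrow> bool" where
  "abs_continuous_dist M \<longleftrightarrow>
     sigma_finite_measure M \<and> absolutely_continuous lborel (distr M borel (\<lambda>\<theta>. \<theta>))"

text \<open>
  Here \<open>K \<theta>\<close> is the distribution of the data given \<open>\<theta>\<close>, and \<open>prior \<bind> K\<close> is the marginal
  distribution of the data. The posterior is a Markov kernel that disintegrates the joint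
  distribution of \<open>(\<theta>, x)\<close> with respect to this marginal. Its values lie in
  \<open>prob_algebra prior\<close>, i.e. the posterior is proper for every \<open>x\<close>.
\<close>

definition is_posterior ::
  "real measure \<Rightarrow> (real \<Rightarrow> 'x measure) \<Rightarrow> 'x measure \<Rightarrow> ('x \<Rightarrow> real measure) \<Rightarrow> bool" where
  "is_posterior prior K X post \<longleftrightarrow>
     post \<in> X \<rightarrow>\<^sub>M prob_algebra prior \<and>
     (\<forall>A\<in>sets X. \<forall>B\<in>sets prior.
        (\<integral>\<^sup>+\<theta>\<in>B. emeasure (K \<theta>) A \<partial>prior) =
        (\<integral>\<^sup>+x\<in>A. emeasure (post x) B \<partial>(prior \<bind> K)))"

definition hypothesis_set :: "real set \<Rightarrow> real \<Rightarrow> int \<Rightarrow> real set" where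
  "hypothesis_set \<Theta> \<theta>\<^sub>0 i =
     (if i = - 1 then {\<theta>\<in>\<Theta>. \<theta> < \<theta>\<^sub>0} else if i = 0 then {\<theta>\<^sub>0} else {\<theta>\<in>\<Theta>. \<theta> > \<theta>\<^sub>0})"

text \<open>The final branch is never reached for \<open>\<theta> \<in> \<Theta>\<close> and \<open>d \<in> {- 1, 0, 1}\<close>.\<close>

definition loss :: "real set \<Rightarrow> real \<Rightarrow> real \<Rightarrow> real \<Rightarrow> int \<Rightarrow> real" where
  "loss \<Theta> \<theta>\<^sub>0 \<alpha> \<theta> d =
     (if \<exists>i\<in>{- 1, 0, 1}. \<theta> \<in> hypothesis_set \<Theta> \<theta>\<^sub>0 i \<and> d = i then 0
      else if \<theta> \<notin> hypothesis_set \<Theta> \<theta>\<^sub>0 0 \<and> d = 0 then \<alpha> / 2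
      else if \<exists>i\<in>{- 1, 1}. \<theta> \<in> hypothesis_set \<Theta> \<theta>\<^sub>0 i \<union> hypothesis_set \<Theta> \<theta>\<^sub>0 0 \<and> d = - i then 1
      else undefined)"

definition expected_loss :: "real measure \<Rightarrow> (real \<Rightarrow> int \<Rightarrow> real) \<Rightarrow> int \<Rightarrow> real" where
  "expected_loss P L d = (LINT \<theta>|P. L \<theta> d)"

definition bayes_test ::
  "'x measure \<Rightarrow> ('x \<Rightarrow> real measure) \<Rightarrow> (real \<Rightarrow> int \<Rightarrow> real) \<Rightarrow> ('x \<Rightarrow> int) \<Rightarrow> bool" where
  "bayes_test X post L \<phi> \<longleftrightarrow>
     (\<forall>x\<in>space X. \<phi> x \<in> {- 1, 0, 1} \<and>
        (\<forall>d\<in>{- 1, 0, 1}. expected_loss (post x) L (\<phi> x) \<le> expected_loss (post x) L d))"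

definition quantile :: "real measure \<Rightarrow> real \<Rightarrow> real" where
  "quantile P \<beta> = (LEAST q. measure P {\<theta>\<in>space P. \<theta> < q} = \<beta>)"

definition central_credible_interval :: "real measure \<Rightarrow> real \<Rightarrow> real set" where
  "central_credible_interval P \<alpha> = {quantile P (\<alpha> / 2) <..< quantile P (1 - \<alpha> / 2)}"

end

theory Submission
  imports Defs
begin

text \<open>
  Write \<open>F(t) = P(\<theta> < t | x)\<close>. Under an atomless posterior, the point \<open>\<theta>\<^sub>0\<close> carries no mass, so
  the decisions \<open>0\<close>, \<open>1\<close> and \<open>-1\<close> have posterior expected losses \<open>\<alpha>/2\<close>, \<open>F(\<theta>\<^sub>0)\<close> and
  \<open>1 - F(\<theta>\<^sub>0)\<close> (lemmas \<open>expected_loss_accept\<close>, \<open>expected_loss_right\<close>, \<open>expected_loss_left\<close>).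
  Acceptance is therefore optimal exactly when \<open>\<alpha>/2 \<le> F(\<theta>\<^sub>0) \<le> 1 - \<alpha>/2\<close>, and otherwise the
  rejection with the smaller expected loss is.

  Absence of atoms also makes \<open>F\<close> continuous, so that its quantiles are attained:
  \<open>F(q\<^sub>\<beta>) = \<beta>\<close> (lemma \<open>prob_less_quantile\<close>). As \<open>F\<close> is monotone, a \<open>\<theta>\<^sub>0\<close> inside the central
  credible interval satisfies both inequalities, whereas a \<open>\<theta>\<^sub>0\<close> outside it has
  \<open>F(\<theta>\<^sub>0) \<le> \<alpha>/2\<close> or \<open>F(\<theta>\<^sub>0) \<ge> 1 - \<alpha>/2\<close>, so that one of the two rejections costs at most \<open>\<alpha>/2\<close>.
  Where \<open>F\<close> is flat at one of these levels, several points qualify as the quantile; the choice among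
  them does not matter, because acceptance and the cheaper rejection then cost the same.
\<close>

lemma (in real_distribution) least_cdf_preimage_attained:
  assumes no_atoms: "\<And>a. measure M {a} = 0" and \<beta>: "0 < \<beta>" "\<beta> < 1"
  shows "cdf M (LEAST q. cdf M q = \<beta>) = \<beta>"
proof -
  have cont: "isCont (cdf M) a" for a
    using no_atoms isCont_cdf by simp
  obtain a where a: "cdf M a < \<beta>"
    using eventually_happens[OF order_tendstoD(2)[OF cdf_lim_at_bot \<beta>(1)]] by auto
  obtain b where b: "\<beta> < cdf M b"
    using eventually_happens[OF order_tendstoD(1)[OF cdf_lim_at_top_prob \<beta>(2)]] by auto
  have above_a: "a \<le> q" if "cdf M q = \<beta>" for q
    using that a cdf_nondecreasing[of q a] by linarith
  have "a \<le> b"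
    using a b cdf_nondecreasing[of b a] by linarith
  then obtain c where c: "cdf M c = \<beta>"
    using IVT[of "cdf M" a \<beta> b] a b cont by auto
  define S where "S = {q. cdf M q = \<beta>}"
  \<comment> \<open>By continuity the level set is closed, and it is bounded below since \<open>cdf M\<close> tends to \<open>0\<close>;
      it thus contains its infimum.\<close>
  have "closed S"
    unfolding S_def using cont
    by (intro closed_Collect_eq) (auto simp: continuous_on_eq_continuous_at)
  moreover have bdd: "bdd_below S"
    by (rule bdd_belowI[of _ a]) (simp add: S_def above_a)
  moreover have "S \<noteq> {}"
    unfolding S_def using c by auto
  ultimately have "Inf S \<in> S"
    by (intro closed_contains_Inf)
  then have "cdf M (Inf S) = \<beta>"
    by (simp add: S_def)
  moreover have "Inf S \<le> q" if "cdf M q = \<beta>" for q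
    using that by (intro cInf_lower[OF _ bdd]) (simp add: S_def)
  ultimately show ?thesis
    by (rule LeastI2_order)
qed

text \<open>The properties of a single posterior distribution from which optimality of the test follows.\<close>

locale atomless_dist_on = prob_space P for P :: "real measure" +
  fixes \<Theta> :: "real set"
  assumes sets_P: "sets P = sets (restrict_space borel \<Theta>)"
    and abs_continuous: "abs_continuous_dist P"
begin

lemma space_P: "space P = \<Theta>"
  using sets_eq_imp_space_eq[OF sets_P] by (simp add: space_restrict_space)

lemma measurable_ident_borel [measurable]: "(\<lambda>\<theta>. \<theta>) \<in> borel_measurable P"
proof -
  have "(\<lambda>\<theta>. \<theta>) \<in> borel_measurable (restrict_space borel \<Theta>)"
    by (rule measurable_restrict_space1) simp
  then show ?thesis
    using measurable_cong_sets[OF sets_P refl] by blast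
qed

abbreviation real_law :: "real measure" where
  "real_law \<equiv> distr P borel (\<lambda>\<theta>. \<theta>)"

lemma real_distribution_real_law: "real_distribution real_law"
  by (rule real_distribution_distr) simp

lemma real_law_singleton: "measure real_law {a} = 0"
proof -
  have "{a} \<in> null_sets real_law"
    using abs_continuous countable_imp_null_set_lborel[of "{a}"]
    unfolding abs_continuous_dist_def absolutely_continuous_def by blast
  then show ?thesis
    by (simp add: measure_eq_0_null_sets)
qed

lemma prob_eq_point: "prob {\<theta>\<in>space P. \<theta> = a} = 0"
proof -
  have "prob {\<theta>\<in>space P. \<theta> = a} = measure real_law {a}"
    by (subst measure_distr) (auto intro!: arg_cong[where f = prob])
  then show ?thesis by (simp add: real_law_singleton)
qed

lemma prob_le_eq_prob_less:
  "prob {\<theta>\<in>space P. \<theta> \<le> a} = prob {\<theta>\<in>space P. \<theta> < a}"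
proof -
  have "prob {\<theta>\<in>space P. \<theta> \<le> a} = prob ({\<theta>\<in>space P. \<theta> < a} \<union> {\<theta>\<in>space P. \<theta> = a})"
    by (rule arg_cong[where f = prob]) auto
  also have "\<dots> = prob {\<theta>\<in>space P. \<theta> < a} + prob {\<theta>\<in>space P. \<theta> = a}"
    by (rule finite_measure_Union) (measurable, auto)
  finally show ?thesis by (simp only: prob_eq_point add_0_right)
qed

lemma prob_ge: "prob {\<theta>\<in>space P. a \<le> \<theta>} = 1 - prob {\<theta>\<in>space P. \<theta> < a}"
  using prob_neg[of "\<lambda>\<theta>. \<theta> < a"] by (simp add: not_less)

lemma prob_neq_point: "prob {\<theta>\<in>space P. \<theta> \<noteq> a} = 1"
proof -
  have "prob {\<theta>\<in>space P. \<theta> \<noteq> a} = 1 - prob {\<theta>\<in>space P. \<theta> = a}"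
    by (rule prob_neg) measurable
  then show ?thesis by (simp only: prob_eq_point diff_zero)
qed

lemma prob_less_mono: "s \<le> t \<Longrightarrow> prob {\<theta>\<in>space P. \<theta> < s} \<le> prob {\<theta>\<in>space P. \<theta> < t}"
  by (rule finite_measure_mono) auto

lemma prob_less_eq_cdf: "prob {\<theta>\<in>space P. \<theta> < q} = cdf real_law q"
proof -
  have "cdf real_law q = prob {\<theta>\<in>space P. \<theta> \<le> q}"
    unfolding cdf_def by (subst measure_distr) (auto intro!: arg_cong[where f = prob])
  then show ?thesis by (simp add: prob_le_eq_prob_less)
qed

text \<open>
  The quantile is defined by a strict inequality, but without atoms it is a quantile of the ordinary
  cumulative distribution function, whose continuity makes the level attained.
\<close>

lemma prob_less_quantile:
  assumes "0 < \<beta>" "\<beta> < 1"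
  shows "prob {\<theta>\<in>space P. \<theta> < quantile P \<beta>} = \<beta>"
  unfolding quantile_def prob_less_eq_cdf
  using real_distribution.least_cdf_preimage_attained
          [OF real_distribution_real_law real_law_singleton assms] .

lemma expected_loss_indicator:
  assumes "\<And>\<theta>. \<theta> \<in> \<Theta> \<Longrightarrow> L \<theta> d = c * indicator {\<theta>\<in>space P. Q \<theta>} \<theta>"
    and [measurable]: "Measurable.pred P Q"
  shows "expected_loss P L d = c * prob {\<theta>\<in>space P. Q \<theta>}"
proof -
  have "expected_loss P L d = (LINT \<theta>|P. c * indicator {\<theta>\<in>space P. Q \<theta>} \<theta>)"
    unfolding expected_loss_def using assms(1) by (intro Bochner_Integration.integral_cong)
      (auto simp: space_P)
  also have "\<dots> = c * prob {\<theta>\<in>space P. Q \<theta>}"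
    by (subst integral_mult_right_zero) (simp add: Int_absorb1)
  finally show ?thesis .
qed

lemma expected_loss_accept: "expected_loss P (loss \<Theta> \<theta>\<^sub>0 \<alpha>) 0 = \<alpha> / 2"
proof -
  have "expected_loss P (loss \<Theta> \<theta>\<^sub>0 \<alpha>) 0 = \<alpha> / 2 * prob {\<theta>\<in>space P. \<theta> \<noteq> \<theta>\<^sub>0}"
    by (rule expected_loss_indicator) (auto simp: loss_def hypothesis_set_def space_P)
  then show ?thesis by (simp add: prob_neq_point)
qed

lemma expected_loss_right:
  "expected_loss P (loss \<Theta> \<theta>\<^sub>0 \<alpha>) 1 = prob {\<theta>\<in>space P. \<theta> < \<theta>\<^sub>0}"
proof -
  have "expected_loss P (loss \<Theta> \<theta>\<^sub>0 \<alpha>) 1 = 1 * prob {\<theta>\<in>space P. \<theta> \<le> \<theta>\<^sub>0}"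
    by (rule expected_loss_indicator) (auto simp: loss_def hypothesis_set_def space_P indicator_def)
  then show ?thesis by (simp add: prob_le_eq_prob_less)
qed

lemma expected_loss_left:
  "expected_loss P (loss \<Theta> \<theta>\<^sub>0 \<alpha>) (- 1) = 1 - prob {\<theta>\<in>space P. \<theta> < \<theta>\<^sub>0}"
proof -
  have "expected_loss P (loss \<Theta> \<theta>\<^sub>0 \<alpha>) (- 1) = 1 * prob {\<theta>\<in>space P. \<theta>\<^sub>0 \<le> \<theta>}"
    by (rule expected_loss_indicator) (auto simp: loss_def hypothesis_set_def space_P indicator_def)
  then show ?thesis by (simp add: prob_ge)
qed

lemma accept_optimal:
  assumes \<alpha>: "0 < \<alpha>" "\<alpha> < 1"
    and inside: "\<theta>\<^sub>0 \<in> central_credible_interval P \<alpha>" and d: "d \<in> {- 1, 0, 1}"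
  shows "expected_loss P (loss \<Theta> \<theta>\<^sub>0 \<alpha>) 0 \<le> expected_loss P (loss \<Theta> \<theta>\<^sub>0 \<alpha>) d"
proof -
  have "quantile P (\<alpha> / 2) \<le> \<theta>\<^sub>0" "\<theta>\<^sub>0 \<le> quantile P (1 - \<alpha> / 2)"
    using inside by (auto simp: central_credible_interval_def)
  from this[THEN prob_less_mono]
  have "\<alpha> / 2 \<le> prob {\<theta>\<in>space P. \<theta> < \<theta>\<^sub>0}" "prob {\<theta>\<in>space P. \<theta> < \<theta>\<^sub>0} \<le> 1 - \<alpha> / 2"
    using \<alpha> by (simp_all add: prob_less_quantile)
  then show ?thesis
    using d by (auto simp: expected_loss_accept expected_loss_left expected_loss_right)
qed

text \<open>
  Outside the interval one of the two rejections costs at most as much as acceptance; the cheaper of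
  the two therefore beats all three decisions.
\<close>

lemma cheaper_rejection_optimal:
  assumes \<alpha>: "0 < \<alpha>" "\<alpha> < 1"
    and outside: "\<theta>\<^sub>0 \<notin> central_credible_interval P \<alpha>"
    and r: "r \<in> {- 1, 1}"
    and cheaper: "expected_loss P (loss \<Theta> \<theta>\<^sub>0 \<alpha>) r \<le> expected_loss P (loss \<Theta> \<theta>\<^sub>0 \<alpha>) (- r)"
    and d: "d \<in> {- 1, 0, 1}"
  shows "expected_loss P (loss \<Theta> \<theta>\<^sub>0 \<alpha>) r \<le> expected_loss P (loss \<Theta> \<theta>\<^sub>0 \<alpha>) d"
proof -
  have "\<theta>\<^sub>0 \<le> quantile P (\<alpha> / 2) \<or> quantile P (1 - \<alpha> / 2) \<le> \<theta>\<^sub>0"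
    using outside by (auto simp: central_credible_interval_def)
  then have "prob {\<theta>\<in>space P. \<theta> < \<theta>\<^sub>0} \<le> \<alpha> / 2 \<or> 1 - \<alpha> / 2 \<le> prob {\<theta>\<in>space P. \<theta> < \<theta>\<^sub>0}"
    using prob_less_mono[of \<theta>\<^sub>0 "quantile P (\<alpha> / 2)"]
      prob_less_mono[of "quantile P (1 - \<alpha> / 2)" \<theta>\<^sub>0] \<alpha>
    by (auto simp: prob_less_quantile)
  then show ?thesis
    using r cheaper d by (auto simp: expected_loss_accept expected_loss_left expected_loss_right)
qed

end

theorem theorem1:
  fixes \<Theta> :: "real set" and \<theta>\<^sub>0 \<alpha> :: real
    and X :: "'x measure" and prior :: "real measure"
    and K :: "real \<Rightarrow> 'x measure" and post :: "'x \<Rightarrow> real measure"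
    and \<phi> :: "'x \<Rightarrow> int"
  assumes "\<theta>\<^sub>0 \<in> \<Theta>"
    and "0 < \<alpha>" and "\<alpha> < 1"
    and "sets prior = sets (restrict_space borel \<Theta>)"
    and "abs_continuous_dist prior"
    and "K \<in> prior \<rightarrow>\<^sub>M prob_algebra X"
    and "is_posterior prior K X post"
    and "\<And>x. x \<in> space X \<Longrightarrow> abs_continuous_dist (post x)"
    and "\<And>x. x \<in> space X \<Longrightarrow> \<phi> x \<in> {- 1, 0, 1}"
    and "\<And>x. x \<in> space X \<Longrightarrow>
           \<phi> x \<noteq> 0 \<longleftrightarrow> \<theta>\<^sub>0 \<notin> central_credible_interval (post x) \<alpha>"
    and "\<And>x. x \<in> space X \<Longrightarrow> \<phi> x \<noteq> 0 \<Longrightarrow>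
           expected_loss (post x) (loss \<Theta> \<theta>\<^sub>0 \<alpha>) (\<phi> x)
             \<le> expected_loss (post x) (loss \<Theta> \<theta>\<^sub>0 \<alpha>) (- \<phi> x)"
  shows "bayes_test X post (loss \<Theta> \<theta>\<^sub>0 \<alpha>) \<phi>"
proof -
  have optimal: "expected_loss (post x) (loss \<Theta> \<theta>\<^sub>0 \<alpha>) (\<phi> x) \<le> expected_loss (post x) (loss \<Theta> \<theta>\<^sub>0 \<alpha>) d"
    if x: "x \<in> space X" and d: "d \<in> {- 1, 0, 1}" for x d
  proof -
    have "post x \<in> space (prob_algebra prior)"
      using assms(7) x by (auto simp: is_posterior_def dest: measurable_space)
    then have "prob_space (post x)" "sets (post x) = sets (restrict_space borel \<Theta>)"
      using assms(4) by (auto simp: space_prob_algebra)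
    then interpret atomless_dist_on "post x" \<Theta>
      using assms(8)[OF x] by (simp add: atomless_dist_on_def atomless_dist_on_axioms_def)
    show ?thesis
    proof (cases "\<phi> x = 0")
      case True
      then show ?thesis
        using accept_optimal[OF assms(2,3) _ d] assms(10)[OF x] by simp
    next
      case False
      then show ?thesis
        using cheaper_rejection_optimal[OF assms(2,3) _ _ assms(11)[OF x] d]
          assms(9)[OF x] assms(10)[OF x] by auto
    qed
  qed
  then show ?thesis
    using assms(9) by (simp add: bayes_test_def)
qed

end
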